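(* Let $\mathbb{K}$ be a field, let $d\ge 0$ be an integer, let $\mathcal{A}$ be a $\mathbb{K}$-algebra isomorphic to $\mathrm{Mat}_{d+1}(\mathbb{K})$, and let $(A;\{E_i\}_{i=0}^d;A^*;\{E^*_i\}_{i=0}^d)$ be a Leonard system in $\mathcal{A}$. Let $\mathcal{X}$ be the $\mathbb{K}$-subspace of $\mathcal{A}$ consisting of all $X\in\mathcal{A}$ such that, for $0\le i,j\le d$ with $|i-j|>1$, both $E_iXE_j=0$ and $E^*_iXE^*_j=0$. Then $\mathcal{X}$ is spanned by $$I,\quad A,\quad A^*,\quad AA^*,\quad A^*A.$$ Moreover, if $d\ge 2$, then these five elements form a basis for $\mathcal{X}$.
   Context: An element $A\in\mathcal{A}$ is multiplicity-free if it has $d+1$ mutually distinct eigenvalues in $\mathbb{K}$. If $A$ is multiplicity-free with eigenvalues $\theta_0,\dots,\theta_d$, the primitive idempotent of $A$ associated with $\theta_i$ is $E_i=\prod_{j\ne i}\frac{A-\theta_jI}{\theta_i-\theta_j}$, where $I$ is the identity of $\mathcal{A}$. A Leonard system in $\mathcal{A}$ is a sequence $(A;\{E_i\}_{i=0}^d;A^*;\{E^*_i\}_{i=0}^d)$ such that: (i) each of $A,A^*$ is a multiplicity-free element of $\mathcal{A}$; (ii) $E_0,\dots,E_d$ is an ordering of the primitive idempotents of $A$; (iii) $E^*_0,\dots,E^*_d$ is an ordering of the primitive idempotents of $A^*$; (iv) for $0\le i,j\le d$, $E_iA^*E_j=0$ if $|i-j|>1$ and $E_iA^*E_j\neq0$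 if $|i-j|=1$; (v) for $0\le i,j\le d$, $E^*_iAE^*_j=0$ if $|i-j|>1$ and $E^*_iAE^*_j\ne0$ if $|i-j|=1$. Here $A^*$ is just a second element of $\mathcal{A}$; the star does not denote conjugate-transpose. *)

theory Defs
  imports "Jordan_Normal_Form.Char_Poly"
begin

text \<open>
  The \<open>K\<close>-algebra is the whole type \<open>'a\<close>, with scalar multiplication \<open>scale\<close>.
  The function \<open>\<phi>\<close> is an arbitrary witness of the isomorphism with \<open>Mat\<^bsub>d+1\<^esub>(K)\<close>.  It is used only
  to say what the eigenvalues of an element of the algebra are; they do not depend on the
  choice of \<open>\<phi>\<close>, see \<open>eigval_iff_not_invertible\<close> below.
\<close>

locale matrix_algebra = vector_space scale
  for scale :: "'k :: field \<Rightarrow> 'a :: ring_1 \<Rightarrow> 'a" (infixr \<open>*s\<close> 75) +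
  fixes d :: nat and \<phi> :: "'a \<Rightarrow> 'k mat"
  assumes scale_mult_left: "(c *s x) * y = c *s (x * y)"
    and scale_mult_right: "x * (c *s y) = c *s (x * y)"
    and \<phi>_bij: "bij_betw \<phi> UNIV (carrier_mat (d + 1) (d + 1))"
    and \<phi>_add: "\<phi> (x + y) = \<phi> x + \<phi> y"
    and \<phi>_mult: "\<phi> (x * y) = \<phi> x * \<phi> y"
    and \<phi>_one: "\<phi> 1 = 1\<^sub>m (d + 1)"
    and \<phi>_scale: "\<phi> (c *s x) = c \<cdot>\<^sub>m \<phi> x"
begin

definition eigval :: "'a \<Rightarrow> 'k \<Rightarrow> bool" where
  "eigval A t \<longleftrightarrow> eigenvalue (\<phi> A) t"

definition multiplicity_free :: "'a \<Rightarrow> bool" where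
  "multiplicity_free A \<longleftrightarrow> card {t. eigval A t} = d + 1"

text \<open>
  The primitive idempotent \<open>\<Prod>\<^bsub>j\<noteq>i\<^esub> (A - \<theta>\<^sub>jI) / (\<theta>\<^sub>i - \<theta>\<^sub>j)\<close>.  The ring is not commutative, hence the
  product of a list; its factors commute, so the order of the indices is immaterial.
\<close>

definition primitive_idempotent :: "'a \<Rightarrow> (nat \<Rightarrow> 'k) \<Rightarrow> nat \<Rightarrow> 'a" where
  "primitive_idempotent A \<theta> i =
     prod_list (map (\<lambda>j. inverse (\<theta> i - \<theta> j) *s (A - \<theta> j *s 1)) (filter (\<lambda>j. j \<noteq> i) [0..<d + 1]))"

definition ordering_of_primitive_idempotents :: "'a \<Rightarrow> (nat \<Rightarrow> 'a) \<Rightarrow> bool" where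
  "ordering_of_primitive_idempotents A E \<longleftrightarrow>
     (\<exists>\<theta>. bij_betw \<theta> {0..d} {t. eigval A t} \<and> (\<forall>i\<le>d. E i = primitive_idempotent A \<theta> i))"

lemma eigval_iff_not_invertible:
  "eigval A t \<longleftrightarrow> \<not> (\<exists>B. B * (A - t *s 1) = 1 \<and> (A - t *s 1) * B = 1)"
proof -
  let ?n = "d + 1"
  have carr: "\<phi> x \<in> carrier_mat ?n ?n" for x
    using \<phi>_bij by (auto simp: bij_betw_def)
  have inj: "\<phi> x = \<phi> y \<longleftrightarrow> x = y" for x y
    using \<phi>_bij by (auto simp: bij_betw_def inj_on_def)
  have surj: "\<exists>x. \<phi> x = M" if "M \<in> carrier_mat ?n ?n" for M
    using \<phi>_bij that unfolding bij_betw_def by (metis imageE)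
  have eq: "\<phi> (A - t *s 1) = char_matrix (\<phi> A) t"
  proof -
    have "A - t *s 1 = A + (- t) *s 1" by simp
    then have "\<phi> (A - t *s 1) = \<phi> A + (- t) \<cdot>\<^sub>m 1\<^sub>m ?n"
      by (simp only: \<phi>_add \<phi>_scale \<phi>_one)
    then show ?thesis using carr[of A] by (simp add: char_matrix_def)
  qed
  have C: "char_matrix (\<phi> A) t \<in> carrier_mat ?n ?n"
    using carr[of "A - t *s 1"] eq by simp
  have "(\<exists>B. B * (A - t *s 1) = 1 \<and> (A - t *s 1) * B = 1) \<longleftrightarrow>
        (\<exists>B. \<phi> B * char_matrix (\<phi> A) t = 1\<^sub>m ?n \<and> char_matrix (\<phi> A) t * \<phi> B = 1\<^sub>m ?n)"
    by (simp only: inj[symmetric] \<phi>_mult \<phi>_one eq)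
  also have "\<dots> \<longleftrightarrow> (\<exists>M \<in> carrier_mat ?n ?n.
        M * char_matrix (\<phi> A) t = 1\<^sub>m ?n \<and> char_matrix (\<phi> A) t * M = 1\<^sub>m ?n)"
    using surj carr by metis
  also have "\<dots> \<longleftrightarrow> det (char_matrix (\<phi> A) t) \<noteq> 0"
  proof
    assume "\<exists>M \<in> carrier_mat ?n ?n.
      M * char_matrix (\<phi> A) t = 1\<^sub>m ?n \<and> char_matrix (\<phi> A) t * M = 1\<^sub>m ?n"
    then obtain M where M: "M \<in> carrier_mat ?n ?n" "M * char_matrix (\<phi> A) t = 1\<^sub>m ?n" by blast
    have "det M * det (char_matrix (\<phi> A) t) = 1"
      using det_mult[OF M(1) C] M(2) by simp
    then show "det (char_matrix (\<phi> A) t) \<noteq> 0" by auto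
  next
    assume "det (char_matrix (\<phi> A) t) \<noteq> 0"
    from det_non_zero_imp_unit[OF C this, of "()"]
    show "\<exists>M \<in> carrier_mat ?n ?n.
      M * char_matrix (\<phi> A) t = 1\<^sub>m ?n \<and> char_matrix (\<phi> A) t * M = 1\<^sub>m ?n"
      by (auto simp: Units_def ring_mat_def)
  qed
  finally show ?thesis
    using eigenvalue_det[OF carr[of A]] by (auto simp: eigval_def)
qed

end

locale leonard_system = matrix_algebra scale d \<phi>
  for scale :: "'k :: field \<Rightarrow> 'a :: ring_1 \<Rightarrow> 'a" (infixr \<open>*s\<close> 75) and d \<phi> +
  fixes A :: 'a and E :: "nat \<Rightarrow> 'a" and A' :: 'a and E' :: "nat \<Rightarrow> 'a"
  assumes mult_free: "multiplicity_free A"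
    and mult_free': "multiplicity_free A'"
    and idempotents: "ordering_of_primitive_idempotents A E"
    and idempotents': "ordering_of_primitive_idempotents A' E'"
    and far: "\<lbrakk>i \<le> d; j \<le> d; \<bar>int i - int j\<bar> > 1\<rbrakk> \<Longrightarrow> E i * A' * E j = 0"
    and near: "\<lbrakk>i \<le> d; j \<le> d; \<bar>int i - int j\<bar> = 1\<rbrakk> \<Longrightarrow> E i * A' * E j \<noteq> 0"
    and far': "\<lbrakk>i \<le> d; j \<le> d; \<bar>int i - int j\<bar> > 1\<rbrakk> \<Longrightarrow> E' i * A * E' j = 0"
    and near': "\<lbrakk>i \<le> d; j \<le> d; \<bar>int i - int j\<bar> = 1\<rbrakk> \<Longrightarrow> E' i * A * E' j \<noteq> 0"

definition leonard_space :: "nat \<Rightarrow> (nat \<Rightarrow> 'a :: ring_1) \<Rightarrow> (nat \<Rightarrow> 'a) \<Rightarrow> 'a set" where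
  "leonard_space d E E' =
     {X. \<forall>i\<le>d. \<forall>j\<le>d. \<bar>int i - int j\<bar> > 1 \<longrightarrow> E i * X * E j = 0 \<and> E' i * X * E' j = 0}"

lemma (in matrix_algebra) subspace_leonard_space: "subspace (leonard_space d E E')"
  by (auto simp: subspace_def leonard_space_def distrib_left distrib_right
      scale_mult_left scale_mult_right)

end

theory Submission
  imports Defs
begin

text \<open>
  Modulo the five elements, an element \<open>X\<close> of the space can be normalised so that, in the
  eigenbasis of \<open>A\<close>, its entries \<open>(0,0)\<close>, \<open>(0,1)\<close>, \<open>(1,0)\<close>, \<open>(1,1)\<close>, \<open>(1,2)\<close> vanish.  Since
  \<open>X E'\<^sub>0 = (p + q A) E'\<^sub>0\<close> and rows \<open>0\<close> and \<open>1\<close> of \<open>X\<close> are zero, \<open>p + q \<theta>\<^sub>0 = p + q \<theta>\<^sub>1 = 0\<close>, whence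
  \<open>X E'\<^sub>0 = 0\<close>.  Column \<open>0\<close> of \<open>X\<close> then gives \<open>E'\<^sub>0 X = 0\<close>, this gives \<open>X E\<^sub>1 = 0\<close>, and columns \<open>0\<close> and \<open>1\<close>
  give \<open>E'\<^sub>1 X = 0\<close>.  The relations \<open>E'\<^sub>0 X = E'\<^sub>0 A X = 0\<close> are two independent linear conditions on
  each column of \<open>X\<close>, and \<open>X E'\<^sub>0 = 0\<close> is one on each row; as \<open>X\<close> is tridiagonal, they kill its columns
  and rows one after the other, so \<open>X = 0\<close>.
\<close>

section \<open>Multiplicity-free elements\<close>

text \<open>Everything after the diagonalization rests on these coordinate-free facts.
  \<open>sandwich_nonzero\<close> expresses that \<open>E i\<close> has rank one, and
  \<open>sandwich_one_dim\<close> that the blocks cut out by \<open>E i\<close> and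
  \<open>E j\<close> form a space of dimension at most one.\<close>

locale idempotent_frame = vector_space scale
  for scale :: "'k :: field \<Rightarrow> 'a :: ring_1 \<Rightarrow> 'a" (infixr \<open>*s\<close> 75) +
  fixes d :: nat and A :: 'a and \<theta> :: "nat \<Rightarrow> 'k" and E :: "nat \<Rightarrow> 'a"
  assumes scale_left: "(c *s x) * y = c *s (x * y)"
    and scale_right: "x * (c *s y) = c *s (x * y)"
    and eigenvalues_inj: "inj_on \<theta> {0..d}"
    and idempotent_mult: "\<lbrakk>i \<le> d; j \<le> d\<rbrakk> \<Longrightarrow> E i * E j = (if i = j then E i else 0)"
    and sum_idempotents: "(\<Sum>i\<le>d. E i) = 1"
    and A_idempotent: "i \<le> d \<Longrightarrow> A * E i = \<theta> i *s E i"
    and idempotent_A: "i \<le> d \<Longrightarrow> E i * A = \<theta> i *s E i"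
    and idempotent_nonzero: "i \<le> d \<Longrightarrow> E i \<noteq> 0"
    and sandwich_nonzero: "\<lbrakk>i \<le> d; Y * E i \<noteq> 0; E i * Z \<noteq> 0\<rbrakk> \<Longrightarrow> Y * E i * Z \<noteq> 0"
    and sandwich_one_dim: "\<lbrakk>i \<le> d; j \<le> d; E i * Z * E j \<noteq> 0\<rbrakk> \<Longrightarrow> \<exists>c. E i * Y * E j = c *s (E i * Z * E j)"

section \<open>Diagonalization of a multiplicity-free element\<close>

context matrix_algebra
begin

lemma \<phi>_carrier: "\<phi> x \<in> carrier_mat (d + 1) (d + 1)"
  using \<phi>_bij by (auto simp: bij_betw_def)

lemma \<phi>_inject: "\<phi> x = \<phi> y \<longleftrightarrow> x = y"
  using \<phi>_bij by (auto simp: bij_betw_def inj_on_def)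

lemma \<phi>_shift_eigenvector:
  assumes v: "v \<in> carrier_vec (d + 1)" and ev: "\<phi> A *\<^sub>v v = t \<cdot>\<^sub>v v"
  shows "\<phi> (c *s (A - s *s 1)) *\<^sub>v v = (c * (t - s)) \<cdot>\<^sub>v v"
proof -
  have "c *s (A - s *s 1) = c *s A + (- (c * s)) *s 1"
    by (simp add: scale_right_diff_distrib)
  then have "\<phi> (c *s (A - s *s 1)) = c \<cdot>\<^sub>m \<phi> A + (- (c * s)) \<cdot>\<^sub>m 1\<^sub>m (d + 1)"
    by (simp only: \<phi>_add \<phi>_scale \<phi>_one)
  then have "\<phi> (c *s (A - s *s 1)) *\<^sub>v v = (c \<cdot>\<^sub>m \<phi> A) *\<^sub>v v + ((- (c * s)) \<cdot>\<^sub>m 1\<^sub>m (d + 1)) *\<^sub>v v"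
    using v \<phi>_carrier[of A] by (simp add: add_mult_distrib_mat_vec[of _ "d + 1" "d + 1"])
  also have "(c \<cdot>\<^sub>m \<phi> A) *\<^sub>v v = c \<cdot>\<^sub>v (\<phi> A *\<^sub>v v)"
    using v \<phi>_carrier[of A] by auto
  also have "((- (c * s)) \<cdot>\<^sub>m 1\<^sub>m (d + 1)) *\<^sub>v v = (- (c * s)) \<cdot>\<^sub>v v"
    using v by auto
  finally show ?thesis
    using v by (auto simp: ev algebra_simps)
qed

lemma \<phi>_prod_eigenvector:
  assumes v: "v \<in> carrier_vec (d + 1)" and ev: "\<phi> A *\<^sub>v v = t \<cdot>\<^sub>v v"
  shows "\<phi> (prod_list (map (\<lambda>j. c j *s (A - s j *s 1)) js)) *\<^sub>v v
    = prod_list (map (\<lambda>j. c j * (t - s j)) js) \<cdot>\<^sub>v v"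
proof (induction js)
  case Nil
  then show ?case using v by (simp add: \<phi>_one)
next
  case (Cons j js)
  let ?P = "prod_list (map (\<lambda>j. c j *s (A - s j *s 1)) js)"
  let ?p = "prod_list (map (\<lambda>j. c j * (t - s j)) js)"
  have "\<phi> (prod_list (map (\<lambda>j. c j *s (A - s j *s 1)) (j # js))) *\<^sub>v v
      = \<phi> (c j *s (A - s j *s 1)) *\<^sub>v (\<phi> ?P *\<^sub>v v)"
    using v \<phi>_carrier by (simp add: \<phi>_mult assoc_mult_mat_vec[of _ "d+1" "d+1" _ "d+1"])
  also have "\<dots> = ?p \<cdot>\<^sub>v (\<phi> (c j *s (A - s j *s 1)) *\<^sub>v v)"
    using v \<phi>_carrier by (simp add: Cons.IH mult_mat_vec[of _ "d+1" "d+1"])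
  also have "\<dots> = prod_list (map (\<lambda>j. c j * (t - s j)) (j # js)) \<cdot>\<^sub>v v"
    by (simp add: \<phi>_shift_eigenvector[OF v ev] smult_smult_assoc mult.commute)
  finally show ?case .
qed

text \<open>The idempotent is a Lagrange interpolation polynomial in \<open>A\<close>: on an
  eigenvector for \<open>\<theta> a\<close> it acts as a product of ratios, all equal to 1 if
  \<open>a = i\<close>, while the factor \<open>j = a\<close> vanishes otherwise.\<close>

lemma \<phi>_primitive_idempotent_eigenvector:
  assumes inj: "inj_on \<theta> {0..d}" and "i \<le> d" "a \<le> d"
    and v: "v \<in> carrier_vec (d + 1)" and ev: "\<phi> A *\<^sub>v v = \<theta> a \<cdot>\<^sub>v v"
  shows "\<phi> (primitive_idempotent A \<theta> i) *\<^sub>v v = (if a = i then 1 else 0) \<cdot>\<^sub>v v"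
proof -
  have "prod_list (map (\<lambda>j. inverse (\<theta> i - \<theta> j) * (\<theta> a - \<theta> j)) (filter (\<lambda>j. j \<noteq> i) [0..<d + 1]))
      = (if a = i then 1 else 0)"
  proof (cases "a = i")
    case True
    have neq: "\<theta> i - \<theta> j \<noteq> 0" if "j < d + 1" "j \<noteq> i" for j
      using inj_onD[OF inj, of i j] \<open>i \<le> d\<close> that by auto
    have ratios: "map (\<lambda>j. inverse (\<theta> i - \<theta> j) * (\<theta> i - \<theta> j)) (filter (\<lambda>j. j \<noteq> i) [0..<d + 1])
        = map (\<lambda>j. 1) (filter (\<lambda>j. j \<noteq> i) [0..<d + 1])"
      by (intro map_cong refl left_inverse neq) (auto simp del: upt_Suc)
    have "prod_list (map (\<lambda>j. 1) js) = (1 :: 'k)" for js :: "nat list"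
      by (induction js) auto
    then show ?thesis by (simp only: True ratios simp_thms if_True)
  next
    case False
    have "a \<in> set (filter (\<lambda>j. j \<noteq> i) [0..<d + 1])"
      using False \<open>a \<le> d\<close> by (auto simp del: upt_Suc)
    then have "0 \<in> set (map (\<lambda>j. inverse (\<theta> i - \<theta> j) * (\<theta> a - \<theta> j)) (filter (\<lambda>j. j \<noteq> i) [0..<d + 1]))"
      unfolding set_map by (rule rev_image_eqI) simp
    then show ?thesis unfolding prod_list_zero_iff[symmetric] using False by simp
  qed
  then show ?thesis
    unfolding primitive_idempotent_def by (simp only: \<phi>_prod_eigenvector[OF v ev])
qed

text \<open>Conjugation of \<open>\<phi>\<close> by a matrix \<open>S\<close> whose columns are
  eigenvectors of \<open>\<phi> A\<close> turns \<open>A\<close> into a diagonal matrix and its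
  primitive idempotents into diagonal matrix units.\<close>

lemma diagonalization:
  assumes bij: "bij_betw \<theta> {0..d} {t. eigval A t}"
  obtains m :: "'a \<Rightarrow> 'k mat" where
    "\<And>x. m x \<in> carrier_mat (d + 1) (d + 1)" "inj m"
    "\<And>x y. m (x * y) = m x * m y" "\<And>x y. m (x + y) = m x + m y"
    "\<And>c x. m (c *s x) = c \<cdot>\<^sub>m m x" "m 1 = 1\<^sub>m (d + 1)"
    "m A = mat (d + 1) (d + 1) (\<lambda>(a, b). if a = b then \<theta> a else 0)"
    "\<And>i. i \<le> d \<Longrightarrow> m (primitive_idempotent A \<theta> i)
       = mat (d + 1) (d + 1) (\<lambda>(a, b). if a = i \<and> b = i then 1 else 0)"
proof -
  let ?n = "d + 1"
  let ?P = "primitive_idempotent A \<theta>"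
  let ?D = "mat ?n ?n (\<lambda>(a, b). if a = b then \<theta> a else 0)"
  let ?U = "\<lambda>i. mat ?n ?n (\<lambda>(a, b). if a = i \<and> b = i then 1 else 0) :: 'k mat"
  have inj: "inj_on \<theta> {0..d}" using bij by (simp add: bij_betw_def)
  have "\<exists>v. eigenvector (\<phi> A) v (\<theta> a)" if "a \<le> d" for a
    using bij that by (auto simp: bij_betw_def eigval_def eigenvalue_def)
  then obtain v where v: "\<And>a. a \<le> d \<Longrightarrow> eigenvector (\<phi> A) (v a) (\<theta> a)" by metis
  have v_carr: "v a \<in> carrier_vec ?n" and v_ev: "\<phi> A *\<^sub>v v a = \<theta> a \<cdot>\<^sub>v v a"
    and v_nz: "v a \<noteq> 0\<^sub>v ?n" if "a \<le> d" for a
    using v[OF that] \<phi>_carrier[of A] by (auto simp: eigenvector_def)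
  define S where "S = mat ?n ?n (\<lambda>(a, b). v b $ a)"
  have S[simp]: "S \<in> carrier_mat ?n ?n" by (simp add: S_def)
  have S_col: "col S a = v a" if "a \<le> d" for a
    using that v_carr[OF that] by (auto simp: S_def)
  have mult_S: "M * S = S * mat ?n ?n (\<lambda>(a, b). if a = b then f a else 0)"
    if M: "M \<in> carrier_mat ?n ?n" and ev: "\<And>a. a \<le> d \<Longrightarrow> M *\<^sub>v v a = f a \<cdot>\<^sub>v v a" for M f
  proof (rule eq_matI)
    fix a b assume ab: "a < dim_row (S * mat ?n ?n (\<lambda>(a, b). if a = b then f a else 0))"
      "b < dim_col (S * mat ?n ?n (\<lambda>(a, b). if a = b then f a else 0))"
    then have ab: "a \<le> d" "b \<le> d" by (auto simp: S_def)
    have "(M * S) $$ (a, b) = (M *\<^sub>v v b) $ a"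
      using ab M by (simp add: S_col S_def[THEN arg_cong[of _ _ dim_col]] S_def[THEN arg_cong[of _ _ dim_row]])
    also have "\<dots> = f b * v b $ a" using ab v_carr[of b] by (simp add: ev)
    also have "\<dots> = (\<Sum>k<?n. v k $ a * (if k = b then f k else 0))"
      using ab by (subst sum.remove[of _ b]) auto
    also have "\<dots> = (S * mat ?n ?n (\<lambda>(a, b). if a = b then f a else 0)) $$ (a, b)"
      using ab by (simp add: S_def scalar_prod_def lessThan_atLeast0)
    finally show "(M * S) $$ (a, b) = (S * mat ?n ?n (\<lambda>(a, b). if a = b then f a else 0)) $$ (a, b)" .
  qed (use M in \<open>auto simp: S_def\<close>)
  have AS: "\<phi> A * S = S * ?D"
    by (rule mult_S[OF \<phi>_carrier v_ev])
  have PS: "\<phi> (?P i) * S = S * ?U i" if "i \<le> d" for i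
  proof -
    have "\<phi> (?P i) * S = S * mat ?n ?n (\<lambda>(a, b). if a = b then if a = i then 1 else 0 else 0)"
      using \<phi>_primitive_idempotent_eigenvector[OF inj that _ v_carr v_ev]
      by (intro mult_S \<phi>_carrier) auto
    also have "mat ?n ?n (\<lambda>(a, b). if a = b then if a = i then 1 else 0 else 0) = ?U i"
      by (rule eq_matI) auto
    finally show ?thesis .
  qed
  \<comment> \<open>Independence of the eigenvectors comes from the idempotents: applying
    \<open>\<phi> (?P i)\<close> to a relation \<open>S *\<^sub>v x = 0\<close> isolates its
    \<open>i\<close>-th term, so \<open>x $ i = 0\<close>.\<close>
  have "det S \<noteq> 0"
  proof
    assume "det S = 0"
    then obtain x where x: "x \<in> carrier_vec ?n" "x \<noteq> 0\<^sub>v ?n" "S *\<^sub>v x = 0\<^sub>v ?n"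
      using det_0_iff_vec_prod_zero_field[OF S] by blast
    have "x $ i = 0" if i: "i \<le> d" for i
    proof -
      have "(S * ?U i) *\<^sub>v x = (\<phi> (?P i) * S) *\<^sub>v x" by (simp add: PS[OF i])
      also have "\<dots> = \<phi> (?P i) *\<^sub>v (S *\<^sub>v x)"
        using x(1) by (intro assoc_mult_mat_vec[OF \<phi>_carrier S])
      also have "\<dots> = 0\<^sub>v ?n" using \<phi>_carrier[of "?P i"] by (auto simp: x(3))
      finally have "S *\<^sub>v (?U i *\<^sub>v x) = 0\<^sub>v ?n"
        using x(1) by (subst assoc_mult_mat_vec[OF S, symmetric]) auto
      also have "?U i *\<^sub>v x = x $ i \<cdot>\<^sub>v unit_vec ?n i"
      proof (rule eq_vecI)
        fix a assume "a < dim_vec (x $ i \<cdot>\<^sub>v unit_vec ?n i)"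
        then show "(?U i *\<^sub>v x) $ a = (x $ i \<cdot>\<^sub>v unit_vec ?n i) $ a"
          using x(1) i by (cases "a = i")
            (auto simp: scalar_prod_def unit_vec_def if_distrib[of "\<lambda>u. u * _"] cong: if_cong)
      qed simp
      also have "S *\<^sub>v (x $ i \<cdot>\<^sub>v unit_vec ?n i) = x $ i \<cdot>\<^sub>v v i"
      proof -
        have "S *\<^sub>v unit_vec ?n i = v i"
          using i v_carr[OF i] by (intro eq_vecI) (auto simp: S_def)
        then show ?thesis by (simp add: mult_mat_vec[OF S])
      qed
      finally have z: "x $ i \<cdot>\<^sub>v v i = 0\<^sub>v ?n" .
      obtain a where a: "a < ?n" "v i $ a \<noteq> 0"
        using v_nz[OF i] v_carr[OF i] by (metis carrier_vecD eq_vecI index_zero_vec)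
      then have "x $ i * v i $ a = 0"
        using arg_cong[OF z, of "\<lambda>w. w $ a"] v_carr[OF i] by simp
      then show ?thesis using a by simp
    qed
    then show False using x(1,2) by (auto intro!: eq_vecI)
  qed
  from det_non_zero_imp_unit[OF S this, of "()"]
  obtain T where T[simp]: "T \<in> carrier_mat ?n ?n" and TS: "T * S = 1\<^sub>m ?n" and ST: "S * T = 1\<^sub>m ?n"
    by (auto simp: Units_def ring_mat_def)
  have cancel: "T * (S * M) = M" "S * (T * M) = M" if "M \<in> carrier_mat ?n ?n" for M
    using assoc_mult_mat[OF T S that] assoc_mult_mat[OF S T that] left_mult_one_mat[OF that]
    by (simp_all add: TS ST)
  define m where "m x = T * (\<phi> x * S)" for x
  have \<phi>S: "\<phi> x * S \<in> carrier_mat ?n ?n" for x by (rule mult_carrier_mat[OF \<phi>_carrier S])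
  have mx: "m x \<in> carrier_mat ?n ?n" for x unfolding m_def by (rule mult_carrier_mat[OF T \<phi>S])
  have S_m: "S * m x = \<phi> x * S" for x
    unfolding m_def by (rule cancel(2)[OF \<phi>S])
  show thesis
  proof (rule that[of m])
    have "\<phi> x = S * m x * T" for x
      using \<phi>_carrier[of x] by (simp only: S_m assoc_mult_mat[OF \<phi>_carrier S T] ST right_mult_one_mat)
    then show "inj m" by (metis \<phi>_inject injI)
    show "m (x * y) = m x * m y" for x y
    proof -
      have "m x * m y = T * (\<phi> x * S * m y)"
        unfolding m_def[of x] by (rule assoc_mult_mat[OF T \<phi>S mx])
      also have "\<phi> x * S * m y = \<phi> x * (\<phi> y * S)"
        by (simp only: assoc_mult_mat[OF \<phi>_carrier S mx] S_m)
      also have "\<dots> = \<phi> (x * y) * S"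
        by (simp only: assoc_mult_mat[OF \<phi>_carrier \<phi>_carrier S] \<phi>_mult)
      finally show ?thesis by (simp only: m_def)
    qed
    show "m (x + y) = m x + m y" for x y
      unfolding m_def \<phi>_add
      by (simp only: add_mult_distrib_mat[OF \<phi>_carrier \<phi>_carrier S] mult_add_distrib_mat[OF T \<phi>S \<phi>S])
    show "m (c *s x) = c \<cdot>\<^sub>m m x" for c x
      unfolding m_def \<phi>_scale
      by (simp only: mult_smult_assoc_mat[OF \<phi>_carrier S] mult_smult_distrib[OF T \<phi>S])
    show "m 1 = 1\<^sub>m ?n" by (simp only: m_def \<phi>_one TS left_mult_one_mat[OF S])
    show "m A = ?D" by (simp add: m_def AS cancel)
    show "m (?P i) = ?U i" if "i \<le> d" for i by (simp add: m_def PS[OF that] cancel)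
  qed (rule mx)
qed

text \<open>In the eigenbasis \<open>E i\<close> is a matrix unit, so each axiom is a comparison of
  entries. The entry of \<open>Y * E i * Z\<close> at \<open>(a, b)\<close> is
  \<open>e Y a i * e Z i b\<close>, and \<open>E i * Y * E j\<close> has only the entry at
  \<open>(i, j)\<close>.\<close>

lemma idempotent_frame:
  assumes bij: "bij_betw \<theta> {0..d} {t. eigval A t}"
    and E: "\<And>i. i \<le> d \<Longrightarrow> E i = primitive_idempotent A \<theta> i"
  shows "idempotent_frame scale d A \<theta> E"
proof -
  let ?n = "d + 1"
  obtain m :: "'a \<Rightarrow> 'k mat" where m_carr: "\<And>x. m x \<in> carrier_mat ?n ?n" and m_inj: "inj m"
    and m_mult: "\<And>x y. m (x * y) = m x * m y" and m_add: "\<And>x y. m (x + y) = m x + m y"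
    and m_scale: "\<And>c x. m (c *s x) = c \<cdot>\<^sub>m m x" and m_one: "m 1 = 1\<^sub>m ?n"
    and m_A: "m A = mat ?n ?n (\<lambda>(a, b). if a = b then \<theta> a else 0)"
    and m_P: "\<And>i. i \<le> d \<Longrightarrow> m (primitive_idempotent A \<theta> i)
       = mat ?n ?n (\<lambda>(a, b). if a = i \<and> b = i then 1 else 0)"
    by (rule diagonalization[OF bij]) (rule that)
  define e where "e x a b = m x $$ (a, b)" for x a b
  have dims: "dim_row (m x) = ?n" "dim_col (m x) = ?n" for x using m_carr[of x] by auto
  have eqI: "x = y" if "\<And>a b. a \<le> d \<Longrightarrow> b \<le> d \<Longrightarrow> e x a b = e y a b" for x y
  proof -
    have "m x = m y" using that by (intro eq_matI) (auto simp: dims e_def)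
    then show ?thesis using m_inj by (simp add: inj_def)
  qed
  have e_add: "e (x + y) a b = e x a b + e y a b" if "a \<le> d" "b \<le> d" for x y a b
    using that by (simp add: e_def m_add dims)
  have e_scale: "e (c *s x) a b = c * e x a b" if "a \<le> d" "b \<le> d" for c x a b
    using that by (simp add: e_def m_scale dims)
  have e_zero: "e 0 a b = 0" if "a \<le> d" "b \<le> d" for a b
    using e_scale[OF that, of 0 0] by simp
  have e_mult: "e (x * y) a b = (\<Sum>k\<le>d. e x a k * e y k b)" if "a \<le> d" "b \<le> d" for x y a b
    using that by (simp add: e_def m_mult dims scalar_prod_def atLeast0LessThan lessThan_Suc_atMost)
  have e_one: "e 1 a b = (if a = b then 1 else 0)" if "a \<le> d" "b \<le> d" for a b
    using that by (simp add: e_def m_one)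
  have e_A: "e A a b = (if a = b then \<theta> a else 0)" if "a \<le> d" "b \<le> d" for a b
    using that by (simp add: e_def m_A)
  have e_E: "e (E i) a b = (if a = i \<and> b = i then 1 else 0)" if "i \<le> d" "a \<le> d" "b \<le> d" for i a b
    using that by (simp add: e_def E m_P)
  have e_E_left: "e (E i * x) a b = (if a = i then e x i b else 0)"
    and e_E_right: "e (x * E i) a b = (if b = i then e x a i else 0)"
    if "i \<le> d" "a \<le> d" "b \<le> d" for i x a b
    using that by (simp_all add: e_mult e_E if_distrib[of "\<lambda>u. u * _"] if_distrib[of "\<lambda>u. _ * u"] cong: if_cong)
  have e_sum: "e (\<Sum>i\<in>I. f i) a b = (\<Sum>i\<in>I. e (f i) a b)"
    if "a \<le> d" "b \<le> d" "finite I" for I :: "nat set" and f a b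
    using that(3) by induction (simp_all add: e_zero e_add that)
  have nz: "\<exists>a\<le>d. \<exists>b\<le>d. e x a b \<noteq> 0" if "x \<noteq> 0" for x
    using that eqI[of x 0] by (auto simp: e_zero)
  show ?thesis
  proof
    show "(c *s x) * y = c *s (x * y)" "x * (c *s y) = c *s (x * y)" for c x y
      by (rule scale_mult_left scale_mult_right)+
    show "inj_on \<theta> {0..d}" using bij by (simp add: bij_betw_def)
    show "E i * E j = (if i = j then E i else 0)" if "i \<le> d" "j \<le> d" for i j
      using that by (intro eqI) (auto simp: e_E_left e_E e_zero)
    show "(\<Sum>i\<le>d. E i) = 1"
      by (intro eqI) (auto simp: e_sum e_E e_one intro!: sum.neutral)
    show "A * E i = \<theta> i *s E i" "E i * A = \<theta> i *s E i" if "i \<le> d" for i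
      using that by (auto intro!: eqI simp: e_E_left e_E_right e_scale e_A e_E)
    show "E i \<noteq> 0" if "i \<le> d" for i
      using e_E[OF that that that] e_zero[OF that that] by auto
    show "Y * E i * Z \<noteq> 0" if i: "i \<le> d" and "Y * E i \<noteq> 0" "E i * Z \<noteq> 0" for i Y Z
    proof -
      obtain a where a: "a \<le> d" "e Y a i \<noteq> 0"
        using nz[OF \<open>Y * E i \<noteq> 0\<close>] i by (auto simp: e_E_right split: if_splits)
      obtain b where b: "b \<le> d" "e Z i b \<noteq> 0"
        using nz[OF \<open>E i * Z \<noteq> 0\<close>] i by (auto simp: e_E_left split: if_splits)
      have "e (Y * (E i * Z)) a b = e Y a i * e Z i b"
        using a b i by (simp add: e_mult[of a b] e_E_left if_distrib[of "\<lambda>u. _ * u"] cong: if_cong)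
      then show ?thesis using a b e_zero[of a b] by (auto simp: mult.assoc)
    qed
    show "\<exists>c. E i * Y * E j = c *s (E i * Z * E j)"
      if ij: "i \<le> d" "j \<le> d" and "E i * Z * E j \<noteq> 0" for i j Y Z
    proof
      have "e Z i j \<noteq> 0"
        using nz[OF \<open>E i * Z * E j \<noteq> 0\<close>] ij by (auto simp: e_E_left e_E_right split: if_splits)
      then show "E i * Y * E j = (e Y i j / e Z i j) *s (E i * Z * E j)"
        using ij by (intro eqI) (auto simp: e_E_left e_E_right e_scale)
    qed
  qed
qed

end

section \<open>Leonard pairs\<close>

definition tridiagonal :: "nat \<Rightarrow> (nat \<Rightarrow> 'a :: ring_1) \<Rightarrow> 'a \<Rightarrow> bool" where
  "tridiagonal d E X \<longleftrightarrow> (\<forall>i\<le>d. \<forall>j\<le>d. \<bar>int i - int j\<bar> > 1 \<longrightarrow> E i * X * E j = 0)"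

lemma leonard_space_iff: "X \<in> leonard_space d E E' \<longleftrightarrow> tridiagonal d E X \<and> tridiagonal d E' X"
  by (auto simp: leonard_space_def tridiagonal_def)

text \<open>The guards remove neighbours outside the range; at \<open>j = 0\<close> truncated
  subtraction would otherwise count \<open>f 0\<close> twice.\<close>

lemma sum_neighbours:
  fixes f :: "nat \<Rightarrow> 'a :: comm_monoid_add"
  assumes "j \<le> d" and "\<And>i. i \<le> d \<Longrightarrow> \<bar>int i - int j\<bar> > 1 \<Longrightarrow> f i = 0"
  shows "(\<Sum>i\<le>d. f i) = (if j = 0 then 0 else f (j - 1)) + f j + (if j < d then f (Suc j) else 0)"
proof -
  let ?T = "(if j = 0 then {} else {j - 1}) \<union> ({j} \<union> (if j < d then {Suc j} else {}))"
  have "f i = 0" if "i \<in> {..d} - ?T" for i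
    using that \<open>j \<le> d\<close> by (intro assms(2)) (auto split: if_splits)
  then have "(\<Sum>i\<le>d. f i) = (\<Sum>i\<in>?T. f i)"
    using \<open>j \<le> d\<close> by (intro sum.mono_neutral_right) (auto split: if_splits)
  also have "\<dots> = (if j = 0 then 0 else f (j - 1)) + (f j + (if j < d then f (Suc j) else 0))"
    by (subst sum.union_disjoint; (subst sum.union_disjoint)?) (auto split: if_splits)
  finally show ?thesis by (simp add: add.assoc)
qed

section \<open>Block expansions of rows and columns\<close>

context idempotent_frame
begin

lemma sum_idempotents_mult: "(\<Sum>i\<le>d. E i * X) = X"
  by (simp add: sum_idempotents flip: sum_distrib_right)

lemma sum_mult_idempotents: "(\<Sum>i\<le>d. X * E i) = X"
  by (simp add: sum_idempotents flip: sum_distrib_left)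

lemma eigenvalues_neq: "\<lbrakk>i \<le> d; j \<le> d; i \<noteq> j\<rbrakk> \<Longrightarrow> \<theta> i \<noteq> \<theta> j"
  using eigenvalues_inj by (auto dest: inj_onD)

lemma tridiagonal_mult_idempotent:
  assumes "tridiagonal d E X" "j \<le> d"
  shows "X * E j = (if j = 0 then 0 else E (j - 1) * X * E j) + E j * X * E j
    + (if j < d then E (Suc j) * X * E j else 0)"
proof -
  have "X * E j = (\<Sum>i\<le>d. E i * X * E j)"
    by (simp add: sum_idempotents_mult mult.assoc)
  then show ?thesis
    using assms by (subst (asm) sum_neighbours[of j]) (auto simp: tridiagonal_def)
qed

lemma idempotent_mult_tridiagonal:
  assumes "tridiagonal d E X" "j \<le> d"
  shows "E j * X = (if j = 0 then 0 else E j * X * E (j - 1)) + E j * X * E j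
    + (if j < d then E j * X * E (Suc j) else 0)"
proof -
  have "E j * X = (\<Sum>i\<le>d. E j * X * E i)"
    by (simp add: sum_mult_idempotents)
  then show ?thesis
    using assms by (subst (asm) sum_neighbours[of j]) (auto simp: tridiagonal_def)
qed

lemma A_idempotent_mult: "i \<le> d \<Longrightarrow> A * (E i * Y) = \<theta> i *s (E i * Y)"
  by (simp add: A_idempotent scale_left flip: mult.assoc)

lemma idempotent_A_mult: "i \<le> d \<Longrightarrow> E i * (A * Y) = \<theta> i *s (E i * Y)"
  by (simp add: idempotent_A scale_left flip: mult.assoc)

lemma sandwich_eq_zero:
  assumes "i \<le> d" "Y * E i * Z = 0"
  shows "Y * E i = 0 \<or> E i * Z = 0"
  using assms sandwich_nonzero by blast

lemma diagonal_block:
  assumes "i \<le> d"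
  obtains c where "E i * Y * E i = c *s E i"
  using sandwich_one_dim[of i i 1 Y] assms by (auto simp: idempotent_mult idempotent_nonzero)

end

section \<open>Leonard systems: nonzero products and vanishing criteria\<close>

locale leonard_frame = L: idempotent_frame scale d A \<theta> E + L': idempotent_frame scale d A' \<theta>' E'
  for scale :: "'k :: field \<Rightarrow> 'a :: ring_1 \<Rightarrow> 'a" (infixr \<open>*s\<close> 75) and d A \<theta> E A' \<theta>' E' +
  assumes tridiagonal_A': "tridiagonal d E A'" and tridiagonal_A: "tridiagonal d E' A"
    and near: "\<lbrakk>i \<le> d; j \<le> d; \<bar>int i - int j\<bar> = 1\<rbrakk> \<Longrightarrow> E i * A' * E j \<noteq> 0"
    and near': "\<lbrakk>i \<le> d; j \<le> d; \<bar>int i - int j\<bar> = 1\<rbrakk> \<Longrightarrow> E' i * A * E' j \<noteq> 0"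
begin

text \<open>The axioms are symmetric in the two families, so every result also holds with their
  roles exchanged.\<close>

lemma dual: "leonard_frame scale d A' \<theta>' E' A \<theta> E"
  by (intro leonard_frame.intro leonard_frame_axioms.intro L.idempotent_frame_axioms
      L'.idempotent_frame_axioms tridiagonal_A' tridiagonal_A near near')

text \<open>
  If \<open>E\<^sub>i E'\<^sub>0 = 0\<close>, then the irreducible tridiagonal action of \<open>A\<close> propagates this to
  \<open>E\<^sub>i E'\<^sub>k = 0\<close> for all \<open>k\<close>.
\<close>

lemma idempotent_mult_first_nonzero:
  assumes i: "i \<le> d"
  shows "E i * E' 0 \<noteq> 0"
proof
  assume zero: "E i * E' 0 = 0"
  have "E i * E' k = 0" if "k \<le> d" for k
    using that
  proof (induction k rule: less_induct)
    case (less k)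
    show ?case
    proof (cases k)
      case 0
      then show ?thesis using zero by simp
    next
      case (Suc j)
      then have j: "j < d" "j \<le> d" using less.prems by auto
      have "E i * (A * E' j) = E i * E' (Suc j) * (A * E' j)"
        using less.IH[of j] less.IH[of "j - 1"] j Suc
        by (subst L'.tridiagonal_mult_idempotent[OF tridiagonal_A, of j])
          (auto simp: algebra_simps simp flip: mult.assoc)
      then have "E i * E' (Suc j) * (A * E' j) = 0"
        using less.IH[of j] Suc j by (simp add: L.idempotent_A_mult[OF i])
      then show ?thesis
        using L'.sandwich_eq_zero[of "Suc j" "E i"] near'[of "Suc j" j] j Suc
        by (auto simp: mult.assoc)
    qed
  qed
  then have "E i = 0"
    using L'.sum_mult_idempotents[of "E i"] by simp
  then show False using L.idempotent_nonzero[OF i] by simp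
qed

text \<open>The same propagation with the factors reversed, along the rows of \<open>A\<close>
  instead of its columns.\<close>

lemma first_mult_idempotent_nonzero:
  assumes i: "i \<le> d"
  shows "E' 0 * E i \<noteq> 0"
proof
  assume zero: "E' 0 * E i = 0"
  have "E' k * E i = 0" if "k \<le> d" for k
    using that
  proof (induction k rule: less_induct)
    case (less k)
    show ?case
    proof (cases k)
      case 0
      then show ?thesis using zero by simp
    next
      case (Suc j)
      then have j: "j < d" "j \<le> d" using less.prems by auto
      have "E' j * A * E i = E' j * A * E' (Suc j) * E i"
        using less.IH[of j] less.IH[of "j - 1"] j Suc
        by (subst L'.idempotent_mult_tridiagonal[OF tridiagonal_A, of j])
          (auto simp: algebra_simps)
      then have "E' j * A * E' (Suc j) * E i = 0"
        using less.IH[of j] Suc j by (simp add: L.A_idempotent[OF i] L.scale_right mult.assoc)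
      then show ?thesis
        using L'.sandwich_eq_zero[of "Suc j" "E' j * A" "E i"] near'[of j "Suc j"] j Suc
        by auto
    qed
  qed
  then have "E i = 0"
    using L'.sum_idempotents_mult[of "E i"] by simp
  then show False using L.idempotent_nonzero[OF i] by simp
qed

text \<open>Only two blocks \<open>?P\<close> and \<open>?Q\<close> of the row can survive. The two
  conditions are a linear system in \<open>?P * E 0\<close> and \<open>?Q * E 0\<close>, invertible
  because the eigenvalues \<open>\<theta>' i\<close> and \<open>\<theta>' (Suc i)\<close> differ;
  the factors \<open>E' k * E 0\<close> are nonzero, so the blocks themselves vanish.\<close>

lemma row_eq_zero:
  assumes tri': "tridiagonal d E' X" and i: "i \<le> d"
    and prev: "i > 0 \<Longrightarrow> E' i * X * E' (i - 1) = 0"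
    and zero: "E' i * X * E 0 = 0" "E' i * X * (A' * E 0) = 0"
  shows "E' i * X = 0"
proof -
  interpret D: leonard_frame scale d A' \<theta>' E' A \<theta> E by (rule dual)
  let ?P = "E' i * X * E' i"
  let ?Q = "if i < d then E' i * X * E' (Suc i) else 0"
  have PQ: "E' i * X = ?P + ?Q"
    using i prev by (subst L'.idempotent_mult_tridiagonal[OF tri']) auto
  have sum: "?P * E 0 + ?Q * E 0 = 0"
    using zero(1) by (subst (asm) PQ) (simp add: distrib_right)
  have "0 = ?P * A' * E 0 + ?Q * A' * E 0"
    using zero(2) by (subst (asm) PQ) (simp add: distrib_right mult.assoc)
  \<comment> \<open>For \<open>i = d\<close> the value \<open>\<theta>' (Suc i)\<close> is not one
    of the eigenvalues, but it multiplies \<open>?Q = 0\<close>.\<close>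
  also have "\<dots> = \<theta>' i *s (?P * E 0) + \<theta>' (Suc i) *s (?Q * E 0)"
    using i by (simp add: mult.assoc L'.idempotent_A_mult L.scale_right)
  also have "?P * E 0 = - (?Q * E 0)"
    using sum by (simp add: eq_neg_iff_add_eq_0)
  finally have "(\<theta>' (Suc i) - \<theta>' i) *s (?Q * E 0) = 0"
    by (simp add: L.scale_left_diff_distrib)
  then have Q0: "?Q * E 0 = 0"
    using L'.eigenvalues_neq[of "Suc i" i] by auto
  have Q: "?Q = 0"
  proof (cases "i < d")
    case True
    then show ?thesis
      using Q0 L'.sandwich_eq_zero[of "Suc i" "E' i * X" "E 0"] D.idempotent_mult_first_nonzero[of "Suc i"]
      by auto
  qed simp
  have "?P * E 0 = 0" using sum Q by simp
  then have "?P = 0"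
    using L'.sandwich_eq_zero[of i "E' i * X" "E 0"] D.idempotent_mult_first_nonzero[of i] i by auto
  then show ?thesis using PQ Q by simp
qed

text \<open>The transposed argument in the eigenbasis of \<open>A\<close>: left multiplication by
  \<open>E' 0\<close> and by \<open>E' 0 * A\<close> gives an invertible system with coefficients
  \<open>\<theta> i\<close> and \<open>\<theta> (Suc i)\<close>.\<close>

lemma column_eq_zero:
  assumes tri: "tridiagonal d E X" and i: "i \<le> d"
    and prev: "i > 0 \<Longrightarrow> E (i - 1) * X * E i = 0"
    and zero: "E' 0 * (X * E i) = 0" "E' 0 * A * (X * E i) = 0"
  shows "X * E i = 0"
proof -
  let ?P = "E i * (X * E i)"
  let ?Q = "if i < d then E (Suc i) * (X * E i) else 0"
  have PQ: "X * E i = ?P + ?Q"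
    using i prev by (subst L.tridiagonal_mult_idempotent[OF tri]) (auto simp: mult.assoc)
  have sum: "E' 0 * ?P + E' 0 * ?Q = 0"
    using zero(1) by (subst (asm) PQ) (simp add: distrib_left)
  have "0 = E' 0 * (A * ?P) + E' 0 * (A * ?Q)"
    using zero(2) by (subst (asm) PQ) (simp add: distrib_left mult.assoc)
  also have "\<dots> = \<theta> i *s (E' 0 * ?P) + \<theta> (Suc i) *s (E' 0 * ?Q)"
    using i by (simp add: L.A_idempotent_mult L.scale_right)
  also have "E' 0 * ?P = - (E' 0 * ?Q)"
    using sum by (simp add: eq_neg_iff_add_eq_0)
  finally have "(\<theta> (Suc i) - \<theta> i) *s (E' 0 * ?Q) = 0"
    by (simp add: L.scale_left_diff_distrib)
  then have Q0: "E' 0 * ?Q = 0"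
    using L.eigenvalues_neq[of "Suc i" i] by auto
  have Q: "?Q = 0"
  proof (cases "i < d")
    case True
    then show ?thesis
      using Q0 L.sandwich_eq_zero[of "Suc i" "E' 0" "X * E i"] first_mult_idempotent_nonzero[of "Suc i"]
      by (auto simp: mult.assoc)
  qed simp
  have "E' 0 * ?P = 0" using sum Q by simp
  then have "?P = 0"
    using L.sandwich_eq_zero[of i "E' 0" "X * E i"] first_mult_idempotent_nonzero[of i] i
    by (auto simp: mult.assoc)
  then show ?thesis using PQ Q by simp
qed

text \<open>At most five blocks determine an element of the space, which is why five generators
  suffice. The last block exists only for \<open>d \<ge> 2\<close>.\<close>

lemma eq_zero_if_corner_zero:
  assumes d: "d \<ge> 1"
    and tri: "tridiagonal d E X" and tri': "tridiagonal d E' X"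
    and corner: "E 0 * X * E 0 = 0" "E 0 * X * E 1 = 0" "E 1 * X * E 0 = 0" "E 1 * X * E 1 = 0"
      "d \<ge> 2 \<Longrightarrow> E 1 * X * E 2 = 0"
  shows "X = 0"
proof -
  interpret D: leonard_frame scale d A' \<theta>' E' A \<theta> E by (rule dual)
  have d0: "0 \<le> d" by simp
  note assoc = mult.assoc
  have row0: "E 0 * X = 0"
    using d corner by (subst L.idempotent_mult_tridiagonal[OF tri]) auto
  have row1: "E 1 * X = 0"
    using d corner by (subst L.idempotent_mult_tridiagonal[OF tri]) (auto simp: numeral_2_eq_2)
  have col0: "X * E 0 = 0"
    using d corner by (subst L.tridiagonal_mult_idempotent[OF tri]) auto

  have col0': "X * E' 0 = 0"
  proof -
    obtain p where p: "E' 0 * X * E' 0 = p *s E' 0"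
      using L'.diagonal_block[of 0] by auto
    obtain a where a: "E' 0 * A * E' 0 = a *s E' 0"
      using L'.diagonal_block[of 0] by auto
    \<comment> \<open>The corresponding block of \<open>A\<close> is nonzero, so that of
      \<open>X\<close> is a multiple of it; the expansion of \<open>A * E' 0\<close> then eliminates
      \<open>E' (Suc 0)\<close>.\<close>
    obtain q where q: "E' (Suc 0) * X * E' 0 = q *s (E' (Suc 0) * A * E' 0)"
      using L'.sandwich_one_dim[of 1 0 A X] near'[of 1 0] d by auto
    have "A * E' 0 = a *s E' 0 + E' (Suc 0) * A * E' 0"
      using d a by (subst L'.tridiagonal_mult_idempotent[OF tridiagonal_A]) auto
    then have E'1: "E' (Suc 0) * A * E' 0 = A * E' 0 - a *s E' 0" by simp
    have X: "X * E' 0 = p *s E' 0 + q *s (A * E' 0 - a *s E' 0)"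
      using d by (subst L'.tridiagonal_mult_idempotent[OF tri']) (auto simp: p q E'1[symmetric])
    \<comment> \<open>Left multiplication by \<open>E i\<close> replaces \<open>A\<close> by
      \<open>\<theta> i\<close>, and \<open>E i * E' 0\<close> is nonzero. Rows 0 and 1 give two
      such equations.\<close>
    have eq: "p + q * (\<theta> i - a) = 0" if i: "i \<le> d" "E i * X = 0" for i
    proof -
      have "0 = E i * (X * E' 0)" using i by (simp flip: assoc)
      also have "\<dots> = (p + q * (\<theta> i - a)) *s (E i * E' 0)"
        unfolding X using i
        by (simp add: distrib_left right_diff_distrib L.scale_right L.idempotent_A_mult
            L.scale_left_distrib L.scale_right_diff_distrib L.scale_left_diff_distrib algebra_simps)
      finally show ?thesis using idempotent_mult_first_nonzero[OF i(1)] by simp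
    qed
    have "q * (\<theta> 0 - \<theta> 1) = 0"
    proof -
      have "q * (\<theta> 0 - \<theta> 1) = (p + q * (\<theta> 0 - a)) - (p + q * (\<theta> 1 - a))"
        by (simp add: algebra_simps)
      also have "\<dots> = 0" by (simp only: eq[OF d0 row0] eq[OF d row1] diff_self)
      finally show ?thesis .
    qed
    then have "q = 0" using L.eigenvalues_neq[of 0 1] d by simp
    then show ?thesis using X eq[of 0] row0 by simp
  qed

  have row0': "E' 0 * X = 0"
  proof -
    \<comment> \<open>The block at \<open>(0, 0)\<close> vanishes by \<open>col0'\<close>. The
      remaining one is killed by \<open>E 0\<close> on the right, although
      \<open>E' (Suc 0) * E 0\<close> is nonzero.\<close>
    have eq: "E' 0 * X = E' 0 * X * E' (Suc 0)"
      using d col0' by (subst L'.idempotent_mult_tridiagonal[OF tri']) (auto simp: assoc)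
    have "E' 0 * X * E' (Suc 0) * E 0 = 0"
      by (subst eq[symmetric]) (simp add: assoc col0)
    then show ?thesis
      using L'.sandwich_eq_zero[of "Suc 0" "E' 0 * X" "E 0"] D.idempotent_mult_first_nonzero[of "Suc 0"] d eq
      by auto
  qed

  have col1: "X * E 1 = 0"
  proof (cases "d \<ge> 2")
    case True
    \<comment> \<open>The blocks above the last one in column 1 are corner blocks. Since
      \<open>E' 0 * X = 0\<close> and \<open>E' 0 * E 2\<close> is nonzero, the last one vanishes
      too.\<close>
    have eq: "X * E 1 = E 2 * (X * E 1)"
      using True d corner
      by (subst L.tridiagonal_mult_idempotent[OF tri]) (auto simp: numeral_2_eq_2 assoc)
    have "E' 0 * E 2 * (X * E 1) = 0"
      by (simp only: assoc eq[symmetric]) (simp add: row0' flip: assoc)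
    then show ?thesis
      using L.sandwich_eq_zero[of 2 "E' 0" "X * E 1"] first_mult_idempotent_nonzero[of 2] True eq
      by auto
  next
    case False
    then show ?thesis
      using d corner by (subst L.tridiagonal_mult_idempotent[OF tri]) auto
  qed

  \<comment> \<open>Multiplication by \<open>X\<close> from the left meets only columns 0 and 1 of
    \<open>X\<close>, which are zero; this supplies the second condition of
    \<open>row_eq_zero\<close>.\<close>
  have "A' * E 0 = E 0 * A' * E 0 + E 1 * A' * E 0"
    using d by (subst L.tridiagonal_mult_idempotent[OF tridiagonal_A']) auto
  then have "X * (A' * E 0) = X * E 0 * (A' * E 0) + X * E 1 * (A' * E 0)"
    by (metis distrib_left assoc)
  then have "X * (A' * E 0) = 0" using col0 col1 by simp
  then have row1': "E' 1 * X = 0"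
    using d col0 col0' by (intro row_eq_zero[OF tri']) (auto simp: assoc)

  have "E' 0 * A = E' 0 * A * E' 0 + E' 0 * A * E' 1"
    using d by (subst L'.idempotent_mult_tridiagonal[OF tridiagonal_A]) auto
  then have "E' 0 * A * X = E' 0 * A * (E' 0 * X) + E' 0 * A * (E' 1 * X)"
    by (metis distrib_right assoc)
  then have AX: "E' 0 * A * X = 0" using row0' row1' by simp

  \<comment> \<open>Rows and columns need a joint induction: row \<open>k\<close> clears the upper
    block of column \<open>k + 1\<close>, and columns \<open>k\<close> and \<open>k + 1\<close>
    leave a single block in row \<open>k + 1\<close>, which \<open>X * E' 0 = 0\<close>
    removes.\<close>
  have "X * E k = 0 \<and> E k * X = 0" if "k \<le> d" for k
    using that
  proof (induction k)
    case 0
    show ?case using row0 col0 by simp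
  next
    case (Suc k)
    then have IH: "X * E k = 0" "E k * X = 0" by simp_all
    have col: "X * E (Suc k) = 0"
      using Suc.prems IH row0' AX by (intro column_eq_zero[OF tri]) (simp_all flip: assoc)
    have eq: "E (Suc k) * X = (if Suc k < d then E (Suc k) * X * E (Suc (Suc k)) else 0)"
      using IH col Suc.prems by (subst L.idempotent_mult_tridiagonal[OF tri]) (auto simp: assoc)
    have "E (Suc k) * X = 0"
    proof (cases "Suc k < d")
      case True
      then have eq': "E (Suc k) * X = E (Suc k) * X * E (Suc (Suc k))" using eq by simp
      have "E (Suc k) * X * E (Suc (Suc k)) * E' 0 = 0"
        by (subst eq'[symmetric]) (simp add: assoc col0')
      then show ?thesis
        using L.sandwich_eq_zero[of "Suc (Suc k)" "E (Suc k) * X" "E' 0"]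
          idempotent_mult_first_nonzero[of "Suc (Suc k)"] True eq' by auto
    qed (use eq in simp)
    then show ?case using col by simp
  qed
  then show ?thesis
    using L.sum_mult_idempotents[of X] by simp
qed

section \<open>Linear combinations of the five generators and their blocks\<close>

definition leonard_combination :: "'k \<Rightarrow> 'k \<Rightarrow> 'k \<Rightarrow> 'k \<Rightarrow> 'k \<Rightarrow> 'a" where
  "leonard_combination a b c e f = a *s 1 + b *s A + c *s A' + e *s (A * A') + f *s (A' * A)"

lemma leonard_combination_in_span:
  "leonard_combination a b c e f \<in> L.span {1, A, A', A * A', A' * A}"
  unfolding leonard_combination_def by (intro L.span_add L.span_scale L.span_base) auto

text \<open>Between \<open>E i\<close> and \<open>E j\<close> the factor \<open>A\<close> becomes
  \<open>\<theta> i\<close> on the left of \<open>A'\<close> and \<open>\<theta> j\<close> on its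
  right, while \<open>1\<close> and \<open>A\<close> contribute nothing off the diagonal.\<close>

lemma leonard_combination_off_diagonal:
  assumes "i \<le> d" "j \<le> d" "i \<noteq> j"
  shows "E i * leonard_combination a b c e f * E j = (c + \<theta> i * e + \<theta> j * f) *s (E i * A' * E j)"
  using assms
  by (simp add: leonard_combination_def distrib_left distrib_right mult.assoc L.scale_left L.scale_right
      L.idempotent_mult L.idempotent_A_mult L.A_idempotent L.scale_left_distrib mult.commute)

lemma leonard_combination_diagonal:
  assumes "i \<le> d"
  shows "E i * leonard_combination a b c e f * E i
    = (a + \<theta> i * b) *s E i + (c + \<theta> i * e + \<theta> i * f) *s (E i * A' * E i)"
  using assms
  by (simp add: leonard_combination_def distrib_left distrib_right mult.assoc L.scale_left L.scale_right
      L.idempotent_mult L.idempotent_A_mult L.A_idempotent L.scale_left_distrib mult.commute)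

lemma tridiagonal_leonard_combination: "tridiagonal d E (leonard_combination a b c e f)"
  unfolding tridiagonal_def
proof (intro allI impI)
  fix i j assume ij: "i \<le> d" "j \<le> d" "\<bar>int i - int j\<bar> > 1"
  then have "i \<noteq> j" by auto
  with ij show "E i * leonard_combination a b c e f * E j = 0"
    using tridiagonal_A' by (auto simp: leonard_combination_off_diagonal tridiagonal_def)
qed

text \<open>Exchanging \<open>A\<close> and \<open>A'\<close> also exchanges the two products, hence
  \<open>b\<close> with \<open>c\<close> and \<open>e\<close> with \<open>f\<close>. This carries
  tridiagonality over to the second family.\<close>

lemma leonard_combination_dual:
  "leonard_frame.leonard_combination scale A' A a c b f e = leonard_combination a b c e f"
  by (simp add: leonard_combination_def leonard_frame.leonard_combination_def[OF dual])

lemma leonard_combination_in_space: "leonard_combination a b c e f \<in> leonard_space d E E'"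
  using tridiagonal_leonard_combination leonard_frame.tridiagonal_leonard_combination[OF dual]
  by (metis leonard_combination_dual leonard_space_iff)

lemma generators_in_space: "{1, A, A', A * A', A' * A} \<subseteq> leonard_space d E E'"
  using leonard_combination_in_space[of 1 0 0 0 0] leonard_combination_in_space[of 0 1 0 0 0]
    leonard_combination_in_space[of 0 0 1 0 0] leonard_combination_in_space[of 0 0 0 1 0]
    leonard_combination_in_space[of 0 0 0 0 1]
  by (simp add: leonard_combination_def)

text \<open>The determinant is \<open>(t0 - t1) * (t0 - t2)\<close>. The case \<open>t1 = t2\<close>
  is allowed and serves \<open>d = 1\<close>.\<close>

lemma off_diagonal_system_solvable:
  fixes t0 t1 t2 :: "'b :: field"
  assumes "t0 \<noteq> t1" "t0 \<noteq> t2"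
  obtains c e f where "c + t0 * e + t1 * f = x" "c + t1 * e + t0 * f = y" "c + t1 * e + t2 * f = z"
proof
  define f where "f = (y - z) / (t0 - t2)"
  define e where "e = (x - y) / (t0 - t1) + f"
  have f: "f * (t0 - t2) = y - z" using assms by (simp add: f_def)
  have e: "(e - f) * (t0 - t1) = x - y" using assms by (simp add: e_def)
  show "(x - t0 * e - t1 * f) + t0 * e + t1 * f = x" by simp
  show y: "(x - t0 * e - t1 * f) + t1 * e + t0 * f = y" using e by (simp add: algebra_simps)
  have "(x - t0 * e - t1 * f) + t1 * e + t2 * f
      = ((x - t0 * e - t1 * f) + t1 * e + t0 * f) - f * (t0 - t2)"
    by (simp add: algebra_simps)
  then show "(x - t0 * e - t1 * f) + t1 * e + t2 * f = z" unfolding y f by simp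
qed

lemma diagonal_system_solvable:
  fixes t0 t1 :: "'b :: field"
  assumes "t0 \<noteq> t1"
  obtains a b where "a + t0 * b = x" "a + t1 * b = y"
proof
  define b where "b = (x - y) / (t0 - t1)"
  have b: "b * (t0 - t1) = x - y" using assms by (simp add: b_def)
  show "(x - t0 * b) + t0 * b = x" by simp
  show "(x - t0 * b) + t1 * b = y" using b by (simp add: algebra_simps)
qed

text \<open>Coefficients are chosen so that the difference from \<open>X\<close> has zero corner
  blocks; then \<open>eq_zero_if_corner_zero\<close> applies. For \<open>d = 0\<close> the only
  idempotent is the identity.\<close>

lemma leonard_space_combination:
  assumes X: "X \<in> leonard_space d E E'"
  obtains a b c e f where "X = leonard_combination a b c e f"
proof (cases "d = 0")
  case True
  then have "E 0 = 1" using L.sum_idempotents by simp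
  then obtain a where "X = a *s 1" using L.diagonal_block[of 0 X] by auto
  then show ?thesis using that[of a 0 0 0 0] by (simp add: leonard_combination_def)
next
  case False
  then have d: "0 \<le> d" "1 \<le> d" by simp_all
  have "\<exists>x. E i * X * E j = x *s (E i * A' * E j)" if "i \<le> d" "j \<le> d" "\<bar>int i - int j\<bar> = 1" for i j
    using L.sandwich_one_dim[OF that(1,2) near[OF that]] .
  then obtain x where x: "E i * X * E j = x i j *s (E i * A' * E j)"
    if "i \<le> d" "j \<le> d" "\<bar>int i - int j\<bar> = 1" for i j by metis
  \<comment> \<open>For \<open>d = 1\<close> there is no third eigenvalue; the substitute keeps the
    system solvable, and the then unconstrained value \<open>x 1 2\<close> does no harm.\<close>
  define t2 where "t2 = (if d \<ge> 2 then \<theta> 2 else \<theta> 1)"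
  have neq: "\<theta> 0 \<noteq> \<theta> 1" "\<theta> 0 \<noteq> t2"
    using L.eigenvalues_neq[of 0 1] L.eigenvalues_neq[of 0 2] d by (auto simp: t2_def)
  obtain c e f where cef: "c + \<theta> 0 * e + \<theta> 1 * f = x 0 1" "c + \<theta> 1 * e + \<theta> 0 * f = x 1 0"
    "c + \<theta> 1 * e + t2 * f = x 1 2"
    by (rule off_diagonal_system_solvable[OF neq])
  \<comment> \<open>The off-diagonal blocks fix \<open>c\<close>, \<open>e\<close>,
    \<open>f\<close>, whose terms also affect the diagonal; \<open>a\<close> and \<open>b\<close>
    are fitted to what remains there.\<close>
  have "\<exists>y. E i * (X - leonard_combination 0 0 c e f) * E i = y *s E i" if "i \<le> d" for i
    using L.diagonal_block[OF that] by metis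
  then obtain y where y: "E i * (X - leonard_combination 0 0 c e f) * E i = y i *s E i"
    if "i \<le> d" for i by metis
  obtain a b where ab: "a + \<theta> 0 * b = y 0" "a + \<theta> 1 * b = y 1"
    by (rule diagonal_system_solvable[OF neq(1)])
  let ?Y = "X - leonard_combination a b c e f"
  have diff: "E i * ?Y * E j = E i * X * E j - E i * leonard_combination a b c e f * E j" for i j
    by (simp add: left_diff_distrib right_diff_distrib)
  have off: "E i * ?Y * E j = 0"
    if "i \<le> d" "j \<le> d" "\<bar>int i - int j\<bar> = 1" "c + \<theta> i * e + \<theta> j * f = x i j" for i j
  proof -
    have "i \<noteq> j" using that(3) by auto
    then show ?thesis using that unfolding diff by (simp add: x leonard_combination_off_diagonal)
  qed
  have diag: "E i * ?Y * E i = 0" if i: "i \<le> d" and "a + \<theta> i * b = y i" for i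
  proof -
    have "E i * ?Y * E i = E i * (X - leonard_combination 0 0 c e f) * E i - (a + \<theta> i * b) *s E i"
      using i by (simp add: left_diff_distrib right_diff_distrib leonard_combination_diagonal)
    then show ?thesis using that by (simp add: y)
  qed
  have "?Y = 0"
  proof (rule eq_zero_if_corner_zero[OF d(2)])
    have "tridiagonal d F ?Y" if "tridiagonal d F X" "tridiagonal d F (leonard_combination a b c e f)" for F
      using that by (simp add: tridiagonal_def left_diff_distrib right_diff_distrib)
    then show "tridiagonal d E ?Y" "tridiagonal d E' ?Y"
      using X leonard_combination_in_space by (simp_all add: leonard_space_iff)
    show "E 0 * ?Y * E 0 = 0" "E 1 * ?Y * E 1 = 0" by (intro diag d ab)+
    show "E 0 * ?Y * E 1 = 0" "E 1 * ?Y * E 0 = 0" using d cef by (auto intro!: off simp del: One_nat_def)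
    show "E 1 * ?Y * E 2 = 0" if "d \<ge> 2" using that cef(3) by (intro off) (auto simp: t2_def)
  qed
  then show ?thesis using that[of a b c e f] by simp
qed

section \<open>Span and linear independence\<close>

lemma span_generators: "L.span {1, A, A', A * A', A' * A} = leonard_space d E E'"
proof
  have "L.subspace (leonard_space d E E')"
    by (auto simp: L.subspace_def leonard_space_def distrib_left distrib_right L.scale_left L.scale_right)
  then show "L.span {1, A, A', A * A', A' * A} \<subseteq> leonard_space d E E'"
    using generators_in_space by (intro L.span_minimal)
  show "leonard_space d E E' \<subseteq> L.span {1, A, A', A * A', A' * A}"
    using leonard_space_combination leonard_combination_in_span by (metis subsetI)
qed

text \<open>The same block equations, now homogeneous. Comparing blocks \<open>(1, 0)\<close> and
  \<open>(1, 2)\<close> isolates \<open>f\<close>, which is where \<open>d \<ge> 2\<close> enters;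
  the other coefficients follow in turn.\<close>

lemma leonard_combination_eq_zero:
  assumes d: "d \<ge> 2" and zero: "leonard_combination a b c e f = 0"
  shows "a = 0 \<and> b = 0 \<and> c = 0 \<and> e = 0 \<and> f = 0"
proof -
  have off: "c + \<theta> i * e + \<theta> j * f = 0" if "i \<le> d" "j \<le> d" "\<bar>int i - int j\<bar> = 1" for i j
  proof -
    have "i \<noteq> j" using that(3) by auto
    then show ?thesis
      using leonard_combination_off_diagonal[of i j a b c e f] near[OF that] that zero by simp
  qed
  have near_pairs: "c + \<theta> 0 * e + \<theta> 1 * f = 0" "c + \<theta> 1 * e + \<theta> 0 * f = 0" "c + \<theta> 1 * e + \<theta> 2 * f = 0"
    using d by (auto intro!: off simp del: One_nat_def)
  have "f * (\<theta> 2 - \<theta> 0) = (c + \<theta> 1 * e + \<theta> 2 * f) - (c + \<theta> 1 * e + \<theta> 0 * f)"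
    by (simp add: algebra_simps)
  then have "f * (\<theta> 2 - \<theta> 0) = 0" by (simp only: near_pairs diff_self)
  then have f: "f = 0" using L.eigenvalues_neq[of 2 0] d by simp
  have "e * (\<theta> 1 - \<theta> 0) = (c + \<theta> 1 * e + \<theta> 0 * f) - (c + \<theta> 0 * e + \<theta> 1 * f)"
    using f by (simp add: algebra_simps)
  then have "e * (\<theta> 1 - \<theta> 0) = 0" by (simp only: near_pairs diff_self)
  then have e: "e = 0" using L.eigenvalues_neq[of 1 0] d by simp
  have c: "c = 0" using near_pairs(1) e f by simp
  have diag: "a + \<theta> i * b = 0" if "i \<le> d" for i
    using leonard_combination_diagonal[OF that, of a b c e f] that zero
    by (simp add: c e f L.idempotent_nonzero)
  have "b * (\<theta> 1 - \<theta> 0) = (a + \<theta> 1 * b) - (a + \<theta> 0 * b)"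
    by (simp add: algebra_simps)
  then have "b * (\<theta> 1 - \<theta> 0) = 0" using diag[of 0] diag[of 1] d by simp
  then have "b = 0" using L.eigenvalues_neq[of 1 0] d by simp
  then show ?thesis using diag[of 0] c e f by simp
qed

text \<open>Two equal generators would give a vanishing combination with coefficients 1 and
  -1.\<close>

lemma generators_distinct:
  assumes "d \<ge> 2"
  shows "distinct [1, A, A', A * A', A' * A]"
proof -
  note eq_zero = leonard_combination_eq_zero[OF assms]
  show ?thesis
    using eq_zero[of 1 "-1" 0 0 0] eq_zero[of 1 0 "-1" 0 0] eq_zero[of 1 0 0 "-1" 0] eq_zero[of 1 0 0 0 "-1"]
      eq_zero[of 0 1 "-1" 0 0] eq_zero[of 0 1 0 "-1" 0] eq_zero[of 0 1 0 0 "-1"]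
      eq_zero[of 0 0 1 "-1" 0] eq_zero[of 0 0 1 0 "-1"] eq_zero[of 0 0 0 1 "-1"]
    by (auto simp: leonard_combination_def)
qed

lemma generators_independent:
  assumes "d \<ge> 2"
  shows "\<not> L.dependent {1, A, A', A * A', A' * A}"
proof -
  have "u 1 = 0 \<and> u A = 0 \<and> u A' = 0 \<and> u (A * A') = 0 \<and> u (A' * A) = 0"
    if "(\<Sum>v\<in>{1, A, A', A * A', A' * A}. u v *s v) = 0" for u
  proof (rule leonard_combination_eq_zero[OF assms])
    \<comment> \<open>Distinctness ensures that the sum over the set really has five terms.\<close>
    show "leonard_combination (u 1) (u A) (u A') (u (A * A')) (u (A' * A)) = 0"
      using that generators_distinct[OF assms] by (simp add: leonard_combination_def add.assoc)
  qed
  then show ?thesis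
    by (subst L.dependent_finite) auto
qed

end

text \<open>\<open>A\<close> and \<open>A'\<close> are diagonalized separately; only the
  tridiagonality and nonvanishing conditions link the two frames.\<close>

lemma (in leonard_system) leonard_frame:
  obtains \<theta> \<theta>' where "leonard_frame scale d A \<theta> E A' \<theta>' E'"
proof -
  obtain \<theta> where \<theta>: "idempotent_frame scale d A \<theta> E"
    using idempotents idempotent_frame unfolding ordering_of_primitive_idempotents_def by blast
  obtain \<theta>' where \<theta>': "idempotent_frame scale d A' \<theta>' E'"
    using idempotents' idempotent_frame unfolding ordering_of_primitive_idempotents_def by blast
  have "leonard_frame_axioms d A E A' E'"
    by standard (auto simp: tridiagonal_def far far' near near')
  with \<theta> \<theta>' show ?thesis by (intro that leonard_frame.intro)
qed

theorem theorem3p2: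
  fixes scale :: "'k :: field \<Rightarrow> 'a :: ring_1 \<Rightarrow> 'a"
    and d :: nat and \<phi> :: "'a \<Rightarrow> 'k mat"
    and A A' :: 'a and E E' :: "nat \<Rightarrow> 'a"
  assumes "leonard_system scale d \<phi> A E A' E'"
  shows "Modules.module.span scale {1, A, A', A * A', A' * A} = leonard_space d E E' \<and>
    (d \<ge> 2 \<longrightarrow>
       distinct [1, A, A', A * A', A' * A] \<and>
       \<not> Modules.module.dependent scale {1, A, A', A * A', A' * A} \<and>
       Modules.module.span scale {1, A, A', A * A', A' * A} = leonard_space d E E')"
proof -
  interpret leonard_system scale d \<phi> A E A' E' by (rule assms)
  obtain \<theta> \<theta>' where "leonard_frame scale d A \<theta> E A' \<theta>' E'" by (rule leonard_frame)
  then interpret F: leonard_frame scale d A \<theta> E A' \<theta>' E' .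
  show ?thesis
    using F.span_generators F.generators_distinct F.generators_independent by blast
qed

end
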